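(* Let $n\ge2$ be an integer. For positive integers $a$, $b$, $c$, and $d$, we have \[ \begin{aligned} \operatorname{vol}\mathcal F_{\mathrm{PS}_{n+2}}(a,b,c,d^{n-2})={}&(a+b+c-2d)\bigl(a+b+c+(n-2)d\bigr)^{n-1}\\ &-(b+c-2d)\bigl(b+c+(n-2)d\bigr)^{n-1}-na(c-d)\bigl(c+(n-2)d\bigr)^{n-2}. \end{aligned} \]
   Context: Flow polytope: let $G$ be a connected directed graph on $\{1,\dots,N+1\}$ with $M$ edges, each of the form $(i,j)$ with $i<j$, with edge set $E$, and let $\mathbf a=(a_1,\dots,a_N)\in\mathbb Z^N$. The flow polytope $\mathcal F_G(\mathbf a)$ is the set of all $(b_e)_{e\in E}\in\mathbb R_{\ge0}^M$ such that $\sum_{e=(i,j)\in E} b_e(\mathbf e_i-\mathbf e_j)=(a_1,\dots,a_N,-\sum_{i=1}^N a_i)$, where $\mathbf e_i$ is the $i$th standard basis vector of $\mathbb R^{N+1}$. Its normalized volume $\operatorname{vol}\mathcal F_G(\mathbf a)$ is $(M-N)!$ times its $(M-N)$-dimensional volume in the affine space cut out by these equations, scaled so that a fundamental parallelepiped of the lattice $\{b\in\mathbb Z^M:\sum b_e(\mathbf e_i-\mathbf e_j)=0\}$ has volume $1$. The Pitman–Stanley graph $\mathrm{PS}_{n+2}$ has vertex set $\{1,\dots,n+2\}$ and edge set $\{(i,i+1):1\le i\le n+1\}\cup\{(i,n+2):1\le i\le n\}$. In a net flow vector, $d^{j}$ denotes the sequence $d,\dots,d$ of $j$ copies of $d$;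 thus $(a,b,c,d^{n-2})$ has $n+1$ entries. *)

theory Defs
  imports "HOL-Analysis.Analysis"
begin

text \<open>
  A graph on the vertices \<open>1, \<dots>, N + 1\<close> is given by its set of edges \<open>(i, j)\<close> with \<open>i < j\<close>.
  Vectors indexed by the edge set \<open>E\<close> are functions on pairs that vanish outside \<open>E\<close>.
\<close>

definition flow_graph :: "nat \<Rightarrow> (nat \<times> nat) set \<Rightarrow> bool" where
  "flow_graph N E \<longleftrightarrow>
     (\<forall>(i, j)\<in>E. 1 \<le> i \<and> i < j \<and> j \<le> N + 1) \<and>
     (\<forall>u\<in>{1..N + 1}. \<forall>v\<in>{1..N + 1}. (u, v) \<in> (E \<union> E\<inverse>)\<^sup>*)"

text \<open>
  \<open>netflow E b\<close> is the vector \<open>\<Sum>e=(i,j)\<in>E. b e (e\<^sub>i - e\<^sub>j)\<close>, read off at coordinate \<open>v\<close>.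
\<close>

definition netflow :: "(nat \<times> nat) set \<Rightarrow> (nat \<times> nat \<Rightarrow> real) \<Rightarrow> nat \<Rightarrow> real" where
  "netflow E b v = (\<Sum>(i, j)\<in>E. b (i, j) * (of_bool (v = i) - of_bool (v = j)))"

definition flow_space :: "(nat \<times> nat) set \<Rightarrow> int list \<Rightarrow> (nat \<times> nat \<Rightarrow> real) set" where
  "flow_space E as = {b. (\<forall>e. e \<notin> E \<longrightarrow> b e = 0) \<and>
     (\<forall>v\<in>{1..length as + 1}. netflow E b v = of_int ((as @ [- sum_list as]) ! (v - 1)))}"

definition flow_polytope :: "(nat \<times> nat) set \<Rightarrow> int list \<Rightarrow> (nat \<times> nat \<Rightarrow> real) set" where
  "flow_polytope E as = {b \<in> flow_space E as. \<forall>e\<in>E. 0 \<le> b e}"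

definition circulation_lattice :: "nat \<Rightarrow> (nat \<times> nat) set \<Rightarrow> (nat \<times> nat \<Rightarrow> real) set" where
  "circulation_lattice N E = {b. (\<forall>e. e \<notin> E \<longrightarrow> b e = 0) \<and> (\<forall>e. b e \<in> \<int>) \<and>
     (\<forall>v\<in>{1..N + 1}. netflow E b v = 0)}"

definition lattice_basis ::
  "(nat \<times> nat \<Rightarrow> real) set \<Rightarrow> nat \<Rightarrow> (nat \<Rightarrow> nat \<times> nat \<Rightarrow> real) \<Rightarrow> bool" where
  "lattice_basis L k w \<longleftrightarrow>
     L = range (\<lambda>(c :: nat \<Rightarrow> int) e. \<Sum>i<k. of_int (c i) * w i e) \<and>
     (\<forall>c :: nat \<Rightarrow> int. (\<forall>e. (\<Sum>i<k. of_int (c i) * w i e) = 0) \<longrightarrow> (\<forall>i<k. c i = 0))"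

text \<open>
  \<open>lattice_coords k p w P\<close> is the set of coordinates of the points of \<open>P\<close> in the affine frame
  with origin \<open>p\<close> and axes \<open>w 0, \<dots>, w (k - 1)\<close>. If the axes form a lattice basis, then Lebesgue
  measure in these coordinates is the volume for which a fundamental parallelepiped of the
  lattice has volume 1.
\<close>

definition lattice_coords ::
  "nat \<Rightarrow> (nat \<times> nat \<Rightarrow> real) \<Rightarrow> (nat \<Rightarrow> nat \<times> nat \<Rightarrow> real) \<Rightarrow>
   (nat \<times> nat \<Rightarrow> real) set \<Rightarrow> (nat \<Rightarrow> real) set" where
  "lattice_coords k p w P =
     {t \<in> {..<k} \<rightarrow>\<^sub>E UNIV. (\<lambda>e. p e + (\<Sum>i<k. t i * w i e)) \<in> P}"

text \<open>
  For a connected graph the lattice has rank \<open>card E - length as\<close>, and the value below depends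
  neither on the chosen origin \<open>p\<close> in the affine space (a change of \<open>p\<close> translates the
  coordinates) nor on the chosen basis \<open>w\<close> (a change of \<open>w\<close> transforms them unimodularly).
\<close>

definition normalized_volume :: "(nat \<times> nat) set \<Rightarrow> int list \<Rightarrow> real" where
  "normalized_volume E as =
     (let k = card E - length as;
          p = (SOME p. p \<in> flow_space E as);
          w = (SOME w. lattice_basis (circulation_lattice (length as) E) k w)
      in fact k * measure (\<Pi>\<^sub>M i\<in>{..<k}. lborel) (lattice_coords k p w (flow_polytope E as)))"

text \<open>The Pitman--Stanley graph on the vertices \<open>1, \<dots>, m\<close>.\<close>

definition PS :: "nat \<Rightarrow> (nat \<times> nat) set" where
  "PS m = {(i, i + 1) |i. 1 \<le> i \<and> i + 1 \<le> m} \<union> {(i, m) |i. 1 \<le> i \<and> i + 2 \<le> m}"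

lemma flow_graph_PS: "flow_graph (n + 1) (PS (n + 2))"
proof -
  let ?R = "PS (n + 2) \<union> (PS (n + 2))\<inverse>"
  have adj: "(m, Suc m) \<in> ?R" "(Suc m, m) \<in> ?R" if "1 \<le> m" "m \<le> n + 1" for m
    using that by (auto simp: PS_def)
  have from_1: "(1, v) \<in> ?R\<^sup>* \<and> (v, 1) \<in> ?R\<^sup>*" if "1 \<le> v" "v \<le> n + 2" for v
    using that
  proof (induction v rule: dec_induct)
    case (step m)
    then have IH: "(1, m) \<in> ?R\<^sup>*" "(m, 1) \<in> ?R\<^sup>*" and m: "1 \<le> m" "m \<le> n + 1"
      by simp_all
    show ?case
      using rtrancl_into_rtrancl[OF IH(1) adj(1)[OF m]]
        converse_rtrancl_into_rtrancl[OF adj(2)[OF m] IH(2)]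
      by blast
  qed simp
  have "(u, v) \<in> ?R\<^sup>*" if "u \<in> {1..n + 1 + 1}" "v \<in> {1..n + 1 + 1}" for u v
    using rtrancl_trans[of u 1 ?R v] from_1[of u] from_1[of v] that by simp
  moreover have "\<forall>(i, j)\<in>PS (n + 2). 1 \<le> i \<and> i < j \<and> j \<le> n + 1 + 1"
    by (auto simp: PS_def)
  ultimately show ?thesis
    unfolding flow_graph_def by blast
qed

end

theory Submission
  imports Defs
begin

text \<open>
  A flow on the Pitman--Stanley graph is determined by its values \<open>x\<^sub>0, \<dots>, x\<^bsub>n-1\<^esub>\<close> on the edges
  into the sink, and in these coordinates the flow polytope is the set of all \<open>x \<ge> 0\<close> whose partial
  sums are bounded by those of the net flow vector. Any basis of the circulation lattice gives
  coordinates that differ from these by a translation and an automorphism of the integer lattice,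
  which preserves Lebesgue measure. Integrating out the coordinates from the last to the first, the
  volume becomes \<open>f 0 0\<close> for functions \<open>f i\<close> with \<open>f n = 1\<close>, \<open>f i' = - f (i + 1)\<close> and a zero of \<open>f i\<close> at
  the bound of the corresponding partial sum. For the net flow \<open>(a, b, c, d, \<dots>, d)\<close> these functions
  have closed forms: Abel polynomials for \<open>i \<ge> 2\<close>, which are integrated twice more.
\<close>

section \<open>Lattice automorphisms preserve Lebesgue measure\<close>

interpretation lborel_product: product_sigma_finite "\<lambda>_. lborel :: real measure"
  by unfold_locales

text \<open>A product measure is determined by its values on boxes. A translation acts on each side
  of a box separately, so invariance of one-dimensional Lebesgue measure suffices.\<close>

lemma nn_integral_PiM_lborel_translate:
  fixes v :: "'i \<Rightarrow> real"
  assumes [simp]: "finite I" and f[measurable]: "f \<in> borel_measurable (\<Pi>\<^sub>M i\<in>I. lborel)"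
  shows "(\<integral>\<^sup>+x. f (\<lambda>i\<in>I. x i + v i) \<partial>(\<Pi>\<^sub>M i\<in>I. lborel)) = (\<integral>\<^sup>+x. f x \<partial>(\<Pi>\<^sub>M i\<in>I. lborel))"
proof -
  let ?M = "\<Pi>\<^sub>M i\<in>I. lborel :: real measure"
  let ?g = "\<lambda>x. \<lambda>i\<in>I. x i + v i"
  have [measurable]: "?g \<in> ?M \<rightarrow>\<^sub>M ?M"
    by (rule measurable_restrict) measurable
  have "distr ?M ?M ?g = ?M"
  proof (rule lborel_product.PiM_eqI)
    fix A :: "'i \<Rightarrow> real set" assume A: "\<And>i. i \<in> I \<Longrightarrow> A i \<in> sets lborel"
    then have PA: "Pi\<^sub>E I A \<in> sets ?M"
      by (auto intro!: sets_PiM_I_finite)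
    let ?B = "\<lambda>i. (\<lambda>x. x + v i) -` A i"
    have B: "?B i \<in> sets lborel" if "i \<in> I" for i
      using measurable_sets_borel[of "\<lambda>x. x + v i" borel "A i"] A[OF that] by simp
    have "emeasure (distr ?M ?M ?g) (Pi\<^sub>E I A) = emeasure ?M (?g -` Pi\<^sub>E I A \<inter> space ?M)"
      using PA by (subst emeasure_distr) auto
    also have "?g -` Pi\<^sub>E I A \<inter> space ?M = Pi\<^sub>E I ?B"
      by (auto simp: space_PiM PiE_iff)
    also have "emeasure ?M \<dots> = (\<Prod>i\<in>I. emeasure lborel (?B i))"
      using B by (intro lborel_product.emeasure_PiM) auto
    also have "\<dots> = (\<Prod>i\<in>I. emeasure lborel (A i))"
    proof (rule prod.cong[OF refl])
      fix i assume "i \<in> I"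
      have "emeasure lborel (A i) = emeasure (distr lborel borel ((+) (v i))) (A i)"
        by (simp add: lborel_distr_plus)
      also have "\<dots> = emeasure lborel (?B i)"
        using A[OF \<open>i \<in> I\<close>] by (subst emeasure_distr) (auto simp: vimage_def add.commute)
      finally show "emeasure lborel (?B i) = emeasure lborel (A i)" ..
    qed
    finally show "emeasure (distr ?M ?M ?g) (Pi\<^sub>E I A) = (\<Prod>i\<in>I. emeasure lborel (A i))" .
  qed simp_all
  then have "(\<integral>\<^sup>+x. f x \<partial>?M) = (\<integral>\<^sup>+x. f x \<partial>distr ?M ?M ?g)" by simp
  also have "\<dots> = (\<integral>\<^sup>+x. f (?g x) \<partial>?M)"
    by (rule nn_integral_distr) auto
  finally show ?thesis ..
qed

section \<open>Tilings by the half-open unit cube\<close>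

lemma nn_integral_of_bool_Ex1:
  assumes "\<exists>!z. z \<in> Z \<and> P z"
  shows "(\<integral>\<^sup>+z. of_bool (P z) \<partial>count_space Z) = (1 :: ennreal)"
proof -
  obtain z0 where z0: "z0 \<in> Z" "P z0" "\<And>z. z \<in> Z \<Longrightarrow> P z \<Longrightarrow> z = z0"
    using assms by blast
  have "(\<integral>\<^sup>+z. of_bool (P z) \<partial>count_space Z) = (\<Sum>z\<in>{z0}. of_bool (P z))"
  proof (rule nn_integral_count_space')
    show "of_bool (P z) = 0" if "z \<in> Z" "z \<notin> {z0}" for z
      using z0(3)[OF that(1)] that(2) by auto
  qed (use z0(1) in auto)
  then show ?thesis using z0(2) by simp
qed

text \<open>The half-open unit cube is a fundamental domain for the integer lattice.\<close>

lemma unit_cube_Ex1_add: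
  fixes y :: "'i \<Rightarrow> real"
  shows "\<exists>!z. z \<in> (\<Pi>\<^sub>E i\<in>I. \<int>) \<and> (\<forall>i\<in>I. y i + z i \<in> {0..<1})"
proof (intro ex1I conjI ballI)
  show "(\<lambda>i\<in>I. - of_int \<lfloor>y i\<rfloor>) \<in> (\<Pi>\<^sub>E i\<in>I. \<int>)" by auto
  show "y i + (\<lambda>i\<in>I. - of_int \<lfloor>y i\<rfloor>) i \<in> {0..<1}" if "i \<in> I" for i
    using that by (simp, linarith)
next
  fix z assume z: "z \<in> (\<Pi>\<^sub>E i\<in>I. \<int>) \<and> (\<forall>i\<in>I. y i + z i \<in> {0..<1})"
  show "z = (\<lambda>i\<in>I. - of_int \<lfloor>y i\<rfloor>)"
  proof (rule PiE_ext)
    show "z \<in> (\<Pi>\<^sub>E i\<in>I. \<int>)" using z by blast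
    show "(\<lambda>i\<in>I. - of_int \<lfloor>y i\<rfloor>) \<in> (\<Pi>\<^sub>E i\<in>I. \<int>)" by auto
    fix i assume i: "i \<in> I"
    then obtain m :: int where m: "z i = of_int m" using z by (auto elim!: Ints_cases dest: PiE_mem)
    have "0 \<le> y i + of_int m" "y i + of_int m < 1" using z i m by auto
    then have "\<lfloor>y i\<rfloor> = - m" by (intro floor_unique) auto
    then show "z i = (\<lambda>i\<in>I. - of_int \<lfloor>y i\<rfloor>) i" using m i by simp
  qed
qed

text \<open>Both signs occur: in \<open>integral_Q_linear\<close> a lattice vector is subtracted
  before the change of variables and its image is added afterwards.\<close>

lemma unit_cube_Ex1_diff:
  fixes y :: "'i \<Rightarrow> real"
  shows "\<exists>!z. z \<in> (\<Pi>\<^sub>E i\<in>I. \<int>) \<and> (\<forall>i\<in>I. y i - z i \<in> {0..<1})"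
proof (intro ex1I conjI ballI)
  show "(\<lambda>i\<in>I. of_int \<lfloor>y i\<rfloor>) \<in> (\<Pi>\<^sub>E i\<in>I. \<int>)" by auto
  show "y i - (\<lambda>i\<in>I. of_int \<lfloor>y i\<rfloor>) i \<in> {0..<1}" if "i \<in> I" for i
    using that by (simp, linarith)
next
  fix z assume z: "z \<in> (\<Pi>\<^sub>E i\<in>I. \<int>) \<and> (\<forall>i\<in>I. y i - z i \<in> {0..<1})"
  show "z = (\<lambda>i\<in>I. of_int \<lfloor>y i\<rfloor>)"
  proof (rule PiE_ext)
    show "z \<in> (\<Pi>\<^sub>E i\<in>I. \<int>)" using z by blast
    show "(\<lambda>i\<in>I. of_int \<lfloor>y i\<rfloor>) \<in> (\<Pi>\<^sub>E i\<in>I. \<int>)" by auto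
    fix i assume i: "i \<in> I"
    then obtain m :: int where m: "z i = of_int m" using z by (auto elim!: Ints_cases dest: PiE_mem)
    have "0 \<le> y i - of_int m" "y i - of_int m < 1" using z i m by auto
    then have "\<lfloor>y i\<rfloor> = m" by (intro floor_unique) auto
    then show "z i = (\<lambda>i\<in>I. of_int \<lfloor>y i\<rfloor>) i" using m i by simp
  qed
qed

section \<open>Linear maps that permute the integer lattice\<close>

definition linear_apply :: "'i set \<Rightarrow> ('i \<Rightarrow> 'i \<Rightarrow> real) \<Rightarrow> ('i \<Rightarrow> real) \<Rightarrow> 'i \<Rightarrow> real" where
  "linear_apply I W t = (\<lambda>i\<in>I. \<Sum>j\<in>I. t j * W j i)"

lemma measurable_linear_apply [measurable]:
  "linear_apply I W \<in> (\<Pi>\<^sub>M i\<in>I. lborel) \<rightarrow>\<^sub>M (\<Pi>\<^sub>M i\<in>I. lborel)"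
  unfolding linear_apply_def
  by (rule measurable_restrict) measurable

lemma linear_apply_add:
  "i \<in> I \<Longrightarrow> linear_apply I W (\<lambda>i\<in>I. x i + y i) i = linear_apply I W x i + linear_apply I W y i"
  by (simp add: linear_apply_def distrib_right sum.distrib)

text \<open>Bijectivity on integer points is what a lattice basis supplies directly; volume
  preservation is derived from it without determinants. Row \<open>W j\<close> is the image of the
  \<open>j\<close>-th unit vector, matching the way \<open>lattice_coords\<close> combines
  axes.\<close>

locale lattice_automorphism =
  fixes I :: "'i set" and W :: "'i \<Rightarrow> 'i \<Rightarrow> real"
  assumes finite_index [simp]: "finite I"
    and bij: "bij_betw (linear_apply I W) (\<Pi>\<^sub>E i\<in>I. \<int>) (\<Pi>\<^sub>E i\<in>I. \<int>)"
begin

abbreviation "\<Lambda> \<equiv> \<Pi>\<^sub>M i\<in>I. (lborel :: real measure)"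

text \<open>Unit vectors are integer points and so have preimages; real combinations of these
  preimages reach every vector.\<close>

lemma surj: "\<exists>x \<in> \<Pi>\<^sub>E i\<in>I. UNIV. \<forall>i\<in>I. linear_apply I W x i = y i"
proof -
  have "\<exists>z. \<forall>i\<in>I. linear_apply I W z i = of_bool (i = k)" for k
  proof -
    have "(\<lambda>i\<in>I. of_bool (i = k)) \<in> (\<Pi>\<^sub>E i\<in>I. \<int>)" by auto
    then obtain z where z: "linear_apply I W z = (\<lambda>i\<in>I. of_bool (i = k))"
      using bij by (metis bij_betw_imp_surj_on imageE)
    show ?thesis by (intro exI[of _ z]) (simp add: z)
  qed
  then obtain z where z: "\<And>k i. i \<in> I \<Longrightarrow> linear_apply I W (z k) i = of_bool (i = k)"
    by metis
  let ?x = "\<lambda>j\<in>I. \<Sum>k\<in>I. y k * z k j"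
  have "linear_apply I W ?x i = y i" if "i \<in> I" for i
  proof -
    have "linear_apply I W ?x i = (\<Sum>j\<in>I. \<Sum>k\<in>I. y k * (z k j * W j i))"
      using that by (simp add: linear_apply_def sum_distrib_right mult.assoc)
    also have "\<dots> = (\<Sum>k\<in>I. y k * linear_apply I W (z k) i)"
      using that by (subst sum.swap) (simp add: linear_apply_def sum_distrib_left)
    also have "\<dots> = (\<Sum>k\<in>I. if i = k then y k else 0)"
      using that by (intro sum.cong) (auto simp only: z of_bool_def split: if_splits)
    also have "\<dots> = y i" using that by simp
    finally show ?thesis .
  qed
  then show ?thesis by (intro bexI[of _ ?x]) auto
qed

text \<open>Looking only at coordinates in \<open>I\<close> allows arguments that are not restricted
  to \<open>I\<close>, such as a pointwise negation.\<close>

definition "Q = (\<lambda>x. of_bool (\<forall>i\<in>I. x i \<in> {0..<1::real}) :: ennreal)"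

lemma Q_cong: "(\<And>i. i \<in> I \<Longrightarrow> x i = y i) \<Longrightarrow> Q x = Q y"
  by (simp add: Q_def)

lemma Q_measurable [measurable]: "Q \<in> borel_measurable \<Lambda>"
  unfolding Q_def by measurable

lemma Q_uminus_measurable [measurable]: "(\<lambda>x. Q (\<lambda>i. - x i)) \<in> borel_measurable \<Lambda>"
  unfolding Q_def by measurable

lemma measurable_coord: "i \<in> I \<Longrightarrow> (\<lambda>x. x i) \<in> borel_measurable \<Lambda>"
  using measurable_component_singleton[of i I "\<lambda>_. lborel :: real measure"] by simp

lemma measurable_linear_apply_comp: "i \<in> I \<Longrightarrow> (\<lambda>x. linear_apply I W x i) \<in> borel_measurable \<Lambda>"
  by (rule measurable_compose[OF measurable_linear_apply measurable_coord])

lemma measurable_shift: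
  "(\<lambda>x. \<lambda>i\<in>I. x i + y i) \<in> \<Lambda> \<rightarrow>\<^sub>M \<Lambda>"
  "(\<lambda>x. \<lambda>i\<in>I. x i - y i) \<in> \<Lambda> \<rightarrow>\<^sub>M \<Lambda>"
  "(\<lambda>x. \<lambda>i\<in>I. linear_apply I W x i + y i) \<in> \<Lambda> \<rightarrow>\<^sub>M \<Lambda>"
  "(\<lambda>x. \<lambda>i\<in>I. y i - linear_apply I W x i) \<in> \<Lambda> \<rightarrow>\<^sub>M \<Lambda>"
  by (rule measurable_restrict,
      simp add: measurable_coord measurable_linear_apply_comp borel_measurable_add borel_measurable_diff)+

lemma integral_box:
  assumes "\<And>i. i \<in> I \<Longrightarrow> B i \<in> sets lborel"
  shows "(\<integral>\<^sup>+x. of_bool (\<forall>i\<in>I. x i \<in> B i) \<partial>\<Lambda>) = (\<Prod>i\<in>I. emeasure lborel (B i))"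
proof -
  have "(\<integral>\<^sup>+x. of_bool (\<forall>i\<in>I. x i \<in> B i) \<partial>\<Lambda>) = (\<integral>\<^sup>+x. indicator (Pi\<^sub>E I B) x \<partial>\<Lambda>)"
    by (intro nn_integral_cong) (auto simp: space_PiM PiE_iff indicator_def)
  also have "\<dots> = emeasure \<Lambda> (Pi\<^sub>E I B)"
    using assms by (intro nn_integral_indicator sets_PiM_I_finite) auto
  also have "\<dots> = (\<Prod>i\<in>I. emeasure lborel (B i))"
    using assms by (intro lborel_product.emeasure_PiM) auto
  finally show ?thesis .
qed

lemma integral_Q: "(\<integral>\<^sup>+x. Q x \<partial>\<Lambda>) = 1"
  unfolding Q_def by (subst integral_box) auto

lemma integral_Q_uminus: "(\<integral>\<^sup>+x. Q (\<lambda>i. - x i) \<partial>\<Lambda>) = 1"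
proof -
  have eq: "- x \<in> {0..<1} \<longleftrightarrow> x \<in> {-1<..0}" for x :: real by auto
  show ?thesis unfolding Q_def eq by (subst integral_box) auto
qed

text \<open>The preimage of the unit cube is again a fundamental domain, so it has volume 1.\<close>

lemma integral_Q_linear: "(\<integral>\<^sup>+x. Q (linear_apply I W x) \<partial>\<Lambda>) = 1"
proof -
  let ?T = "linear_apply I W" and ?Z = "\<Pi>\<^sub>E i\<in>I. (\<int> :: real set)"
  have Z: "countable ?Z" by (intro countable_PiE) (auto simp: Ints_def)
  have sum_diff: "(\<integral>\<^sup>+z. Q (\<lambda>i\<in>I. y i - z i) \<partial>count_space ?Z) = 1" for y
    unfolding Q_def using nn_integral_of_bool_Ex1[OF unit_cube_Ex1_diff[of I y]] by simp
  have sum_add: "(\<integral>\<^sup>+z. Q (\<lambda>i\<in>I. y i + z i) \<partial>count_space ?Z) = 1" for y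
    unfolding Q_def using nn_integral_of_bool_Ex1[OF unit_cube_Ex1_add[of I y]] by simp
  note Q_comp = measurable_compose[OF _ Q_measurable]
  note QT = Q_comp[OF measurable_linear_apply]
  note [measurable del] = measurable_linear_apply
  \<comment> \<open>Insert the factor 1, written as the sum over all lattice translates of the unit
    cube.\<close>
  have "(\<integral>\<^sup>+x. Q (?T x) \<partial>\<Lambda>) = (\<integral>\<^sup>+x. \<integral>\<^sup>+z. Q (\<lambda>i\<in>I. x i - z i) * Q (?T x) \<partial>count_space ?Z \<partial>\<Lambda>)"
    by (simp add: nn_integral_multc sum_diff)
  also have "\<dots> = (\<integral>\<^sup>+z. \<integral>\<^sup>+x. Q (\<lambda>i\<in>I. x i - z i) * Q (?T x) \<partial>\<Lambda> \<partial>count_space ?Z)"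
    by (rule nn_integral_count_space_nn_integral[OF Z])
      (intro borel_measurable_times_ennreal QT Q_comp[OF measurable_shift(2)])
  \<comment> \<open>Replacing \<open>x\<close> by \<open>x + z\<close> moves the lattice vector from
    the first factor into the second, where it appears as \<open>?T z\<close>.\<close>
  also have "\<dots> = (\<integral>\<^sup>+z. \<integral>\<^sup>+x. Q x * Q (\<lambda>i\<in>I. ?T x i + ?T z i) \<partial>\<Lambda> \<partial>count_space ?Z)"
  proof (rule nn_integral_cong)
    fix z
    have "(\<integral>\<^sup>+x. Q (\<lambda>i\<in>I. x i - z i) * Q (?T x) \<partial>\<Lambda>) =
        (\<integral>\<^sup>+x. Q (\<lambda>i\<in>I. (\<lambda>i\<in>I. x i + z i) i - z i) * Q (?T (\<lambda>i\<in>I. x i + z i)) \<partial>\<Lambda>)"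
      by (rule nn_integral_PiM_lborel_translate[symmetric, OF finite_index])
        (intro borel_measurable_times_ennreal QT Q_comp[OF measurable_shift(2)])
    also have "\<dots> = (\<integral>\<^sup>+x. Q x * Q (\<lambda>i\<in>I. ?T x i + ?T z i) \<partial>\<Lambda>)"
      by (intro nn_integral_cong arg_cong2[of _ _ _ _ "(*)"] Q_cong) (simp_all add: linear_apply_add)
    finally show "(\<integral>\<^sup>+x. Q (\<lambda>i\<in>I. x i - z i) * Q (?T x) \<partial>\<Lambda>) = \<dots>" .
  qed
  also have "\<dots> = (\<integral>\<^sup>+x. \<integral>\<^sup>+z. Q x * Q (\<lambda>i\<in>I. ?T x i + ?T z i) \<partial>count_space ?Z \<partial>\<Lambda>)"
    by (rule nn_integral_count_space_nn_integral[OF Z, symmetric])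
      (intro borel_measurable_times_ennreal Q_measurable Q_comp[OF measurable_shift(3)])
  also have "\<dots> = (\<integral>\<^sup>+x. Q x \<partial>\<Lambda>)"
  proof (rule nn_integral_cong)
    fix x
    \<comment> \<open>As \<open>z\<close> runs through the lattice, so does \<open>?T z\<close>; the
      cubes shifted by these vectors tile the space.\<close>
    have "(\<integral>\<^sup>+z. Q (\<lambda>i\<in>I. ?T x i + ?T z i) \<partial>count_space ?Z) = 1"
      using nn_integral_bij_count_space[OF bij, of "\<lambda>z. Q (\<lambda>i\<in>I. ?T x i + z i)"] sum_add[of "?T x"] by simp
    then show "(\<integral>\<^sup>+z. Q x * Q (\<lambda>i\<in>I. ?T x i + ?T z i) \<partial>count_space ?Z) = Q x"
      by (simp add: nn_integral_cmult)
  qed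
  finally show ?thesis by (simp add: integral_Q)
qed

text \<open>
  Uniqueness of Haar measure: evaluate the double integral of \<open>f (W x) * Q (y - W x)\<close> in both
  orders, translating \<open>x\<close> by a preimage of \<open>y\<close> in the second one.
\<close>

lemma nn_integral_linear_apply:
  assumes f[measurable]: "f \<in> borel_measurable \<Lambda>"
  shows "(\<integral>\<^sup>+x. f (linear_apply I W x) \<partial>\<Lambda>) = (\<integral>\<^sup>+x. f x \<partial>\<Lambda>)"
proof -
  let ?T = "linear_apply I W"
  \<comment> \<open>The mirrored cube: once \<open>x\<close> is shifted by a preimage of
    \<open>y\<close>, the difference \<open>y - ?T x\<close> becomes \<open>- ?T x\<close>, and the
    two signs cancel to \<open>Q (?T x)\<close>.\<close>
  let ?Q' = "\<lambda>x. Q (\<lambda>i. - x i)"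
  have "sigma_finite_measure \<Lambda>" by (rule lborel_product.sigma_finite) simp
  then have "pair_sigma_finite \<Lambda> \<Lambda>" by (simp add: pair_sigma_finite_def)
  note Fubini' = pair_sigma_finite.Fubini'[OF this]
  have diff: "(\<lambda>p. \<lambda>i\<in>I. fst p i - ?T (snd p) i) \<in> \<Lambda> \<Otimes>\<^sub>M \<Lambda> \<rightarrow>\<^sub>M \<Lambda>"
    by (rule measurable_restrict, simp)
      (intro borel_measurable_diff measurable_compose[OF measurable_fst measurable_coord]
        measurable_compose[OF measurable_snd measurable_linear_apply_comp])
  have add: "(\<lambda>p. \<lambda>i\<in>I. ?T (fst p) i + snd p i) \<in> \<Lambda> \<Otimes>\<^sub>M \<Lambda> \<rightarrow>\<^sub>M \<Lambda>"
    by (rule measurable_restrict, simp)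
      (intro borel_measurable_add measurable_compose[OF measurable_snd measurable_coord]
        measurable_compose[OF measurable_fst measurable_linear_apply_comp])
  note Q'_comp = measurable_compose[OF _ Q_uminus_measurable]
  note f_comp = measurable_compose[OF _ f]
  have "(\<integral>\<^sup>+x. f (?T x) \<partial>\<Lambda>) = (\<integral>\<^sup>+x. f (?T x) * (\<integral>\<^sup>+y. ?Q' y \<partial>\<Lambda>) \<partial>\<Lambda>)"
    by (simp add: integral_Q_uminus)
  also have "\<dots> = (\<integral>\<^sup>+x. \<integral>\<^sup>+y. f (?T x) * ?Q' (\<lambda>i\<in>I. y i - ?T x i) \<partial>\<Lambda> \<partial>\<Lambda>)"
  proof (rule nn_integral_cong)
    fix x
    have "(\<integral>\<^sup>+y. ?Q' y \<partial>\<Lambda>) = (\<integral>\<^sup>+y. ?Q' (\<lambda>i\<in>I. y i + - ?T x i) \<partial>\<Lambda>)"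
      by (rule nn_integral_PiM_lborel_translate[symmetric, OF finite_index Q_uminus_measurable])
    then show "f (?T x) * (\<integral>\<^sup>+y. ?Q' y \<partial>\<Lambda>) = (\<integral>\<^sup>+y. f (?T x) * ?Q' (\<lambda>i\<in>I. y i - ?T x i) \<partial>\<Lambda>)"
      using nn_integral_cmult[OF Q'_comp[OF measurable_shift(2)], of "f (?T x)" "?T x"] by simp
  qed
  also have "\<dots> = (\<integral>\<^sup>+y. \<integral>\<^sup>+x. f (?T x) * ?Q' (\<lambda>i\<in>I. y i - ?T x i) \<partial>\<Lambda> \<partial>\<Lambda>)"
    by (rule Fubini') (simp only: split_beta'; intro borel_measurable_times_ennreal Q'_comp[OF diff]
      measurable_compose[OF measurable_snd measurable_compose[OF measurable_linear_apply f]])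
  also have "\<dots> = (\<integral>\<^sup>+y. \<integral>\<^sup>+x. f (\<lambda>i\<in>I. ?T x i + y i) * Q (?T x) \<partial>\<Lambda> \<partial>\<Lambda>)"
  proof (rule nn_integral_cong)
    fix y
    obtain u where u: "\<And>i. i \<in> I \<Longrightarrow> ?T u i = y i" using surj[of y] by blast
    have Tu: "?T (\<lambda>i\<in>I. x i + u i) = (\<lambda>i\<in>I. ?T x i + y i)" for x
    proof
      show "?T (\<lambda>i\<in>I. x i + u i) i = (\<lambda>i\<in>I. ?T x i + y i) i" for i
        by (cases "i \<in> I") (simp_all add: linear_apply_add u, simp add: linear_apply_def)
    qed
    have "(\<integral>\<^sup>+x. f (?T x) * ?Q' (\<lambda>i\<in>I. y i - ?T x i) \<partial>\<Lambda>) =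
       (\<integral>\<^sup>+x. f (?T (\<lambda>i\<in>I. x i + u i)) * ?Q' (\<lambda>i\<in>I. y i - ?T (\<lambda>i\<in>I. x i + u i) i) \<partial>\<Lambda>)"
      by (rule nn_integral_PiM_lborel_translate[symmetric, OF finite_index])
        (intro borel_measurable_times_ennreal f_comp[OF measurable_linear_apply] Q'_comp[OF measurable_shift(4)])
    also have "\<dots> = (\<integral>\<^sup>+x. f (\<lambda>i\<in>I. ?T x i + y i) * Q (?T x) \<partial>\<Lambda>)"
      unfolding Tu by (intro nn_integral_cong arg_cong2[of _ _ _ _ "(*)"] Q_cong) auto
    finally show "(\<integral>\<^sup>+x. f (?T x) * ?Q' (\<lambda>i\<in>I. y i - ?T x i) \<partial>\<Lambda>) = \<dots>" .
  qed
  also have "\<dots> = (\<integral>\<^sup>+x. \<integral>\<^sup>+y. f (\<lambda>i\<in>I. ?T x i + y i) * Q (?T x) \<partial>\<Lambda> \<partial>\<Lambda>)"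
    by (rule Fubini') (simp only: split_beta'; intro borel_measurable_times_ennreal f_comp[OF add]
      measurable_compose[OF measurable_fst measurable_compose[OF measurable_linear_apply Q_measurable]])
  also have "\<dots> = (\<integral>\<^sup>+x. (\<integral>\<^sup>+y. f y \<partial>\<Lambda>) * Q (?T x) \<partial>\<Lambda>)"
  proof (rule nn_integral_cong)
    fix x
    have "(\<integral>\<^sup>+y. f (\<lambda>i\<in>I. ?T x i + y i) * Q (?T x) \<partial>\<Lambda>) =
        (\<integral>\<^sup>+y. f (\<lambda>i\<in>I. y i + ?T x i) \<partial>\<Lambda>) * Q (?T x)"
      using nn_integral_multc[OF f_comp[OF measurable_shift(1)], of "?T x" "Q (?T x)"] by (simp add: add.commute)
    also have "(\<integral>\<^sup>+y. f (\<lambda>i\<in>I. y i + ?T x i) \<partial>\<Lambda>) = (\<integral>\<^sup>+y. f y \<partial>\<Lambda>)"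
      by (rule nn_integral_PiM_lborel_translate[OF finite_index f])
    finally show "(\<integral>\<^sup>+y. f (\<lambda>i\<in>I. ?T x i + y i) * Q (?T x) \<partial>\<Lambda>) = (\<integral>\<^sup>+y. f y \<partial>\<Lambda>) * Q (?T x)" .
  qed
  also have "\<dots> = (\<integral>\<^sup>+y. f y \<partial>\<Lambda>)"
    by (simp add: nn_integral_cmult integral_Q_linear)
  finally show ?thesis .
qed

end

section \<open>Flows on the Pitman--Stanley graph\<close>

text \<open>
  The vector on the edges of \<open>PS (Suc (Suc n))\<close> with entry \<open>x l\<close> on the edge \<open>(Suc l, Suc (Suc n))\<close> whose net
  flow has partial sums \<open>A\<close>.
\<close>

definition PS_flow :: "nat \<Rightarrow> (nat \<Rightarrow> real) \<Rightarrow> (nat \<Rightarrow> real) \<Rightarrow> nat \<times> nat \<Rightarrow> real" where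
  "PS_flow n A x = (\<lambda>(i, j). if 1 \<le> i \<and> i \<le> Suc n \<and> j = Suc i then A i - sum x {..<min i n}
     else if 1 \<le> i \<and> i \<le> n \<and> j = Suc (Suc n) then x (i - 1) else 0)"

text \<open>Indices start at 0 to match coordinates in \<open>{..<n}\<close>. The edge from
  \<open>Suc n\<close> to the sink counts as part of the spine \<open>i -> Suc i\<close>, which
  leaves \<open>n\<close> spokes, as many as the dimension.\<close>

abbreviation spokes :: "nat \<Rightarrow> (nat \<times> nat \<Rightarrow> real) \<Rightarrow> nat \<Rightarrow> real" where
  "spokes n b l \<equiv> b (Suc l, Suc (Suc n))"

lemma PS_eq: "PS (Suc (Suc n)) = (\<lambda>i. (i, Suc i)) ` {Suc 0..Suc n} \<union> (\<lambda>i. (i, Suc (Suc n))) ` {Suc 0..n}"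
  by (auto simp: PS_def)

lemma sum_PS: "(\<Sum>e\<in>PS (Suc (Suc n)). g e) = (\<Sum>i=Suc 0..Suc n. g (i, Suc i)) + (\<Sum>i=Suc 0..n. g (i, Suc (Suc n)))"
proof -
  have "(\<Sum>e\<in>PS (Suc (Suc n)). g e) =
      (\<Sum>e\<in>(\<lambda>i. (i, Suc i)) ` {Suc 0..Suc n}. g e) + (\<Sum>e\<in>(\<lambda>i. (i, Suc (Suc n))) ` {Suc 0..n}. g e)"
    unfolding PS_eq by (rule sum.union_disjoint) auto
  then show ?thesis by (simp add: sum.reindex inj_on_def)
qed

lemma card_PS: "card (PS (Suc (Suc n))) = 2 * n + 1"
  using sum_PS[of "\<lambda>_. 1 :: nat" n] by simp

lemma PS_flow_spoke: "l < n \<Longrightarrow> PS_flow n A x (Suc l, Suc (Suc n)) = x l"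
  by (simp add: PS_flow_def)

lemma PS_flow_outside: "e \<notin> PS (Suc (Suc n)) \<Longrightarrow> PS_flow n A x e = 0"
  unfolding PS_eq by (cases e) (auto simp: PS_flow_def)

lemma PS_flow_cong:
  assumes "\<And>i. 1 \<le> i \<Longrightarrow> i \<le> Suc n \<Longrightarrow> A i = A' i" and "\<And>l. l < n \<Longrightarrow> x l = x' l"
  shows "PS_flow n A x = PS_flow n A' x'"
proof -
  have "sum x {..<min i n} = sum x' {..<min i n}" for i
    using assms(2) by (intro sum.cong) auto
  then show ?thesis using assms by (auto simp: PS_flow_def fun_eq_iff)
qed

text \<open>Spine entries are affine in the spokes, so adding a combination of circulations amounts
  to adding the same combination of their spokes.\<close>

lemma PS_flow_linear:
  "PS_flow n A x e + (\<Sum>j<k. t j * PS_flow n (\<lambda>_. 0) (y j) e) =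
   PS_flow n A (\<lambda>l. x l + (\<Sum>j<k. t j * y j l)) e"
proof -
  have lin: "A i - sum x S + (\<Sum>j<k. t j * - sum (y j) S) = A i - (\<Sum>l\<in>S. x l + (\<Sum>j<k. t j * y j l))" for i S
    by (subst sum.distrib, subst sum.swap) (simp add: sum_distrib_left sum_negf)
  obtain i j where e: "e = (i, j)" by (cases e)
  consider (spine) "1 \<le> i \<and> i \<le> Suc n \<and> j = Suc i"
    | (spoke) "\<not> (1 \<le> i \<and> i \<le> Suc n \<and> j = Suc i)" "1 \<le> i \<and> i \<le> n \<and> j = Suc (Suc n)"
    | (none) "\<not> (1 \<le> i \<and> i \<le> Suc n \<and> j = Suc i)" "\<not> (1 \<le> i \<and> i \<le> n \<and> j = Suc (Suc n))"
    by blast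
  then show ?thesis
  proof cases
    case spine
    then show ?thesis using lin[of i "{..<min i n}"] by (simp add: PS_flow_def e)
  next
    case spoke
    then show ?thesis by (simp only: PS_flow_def prod.case e if_False if_True simp_thms)
  next
    case none
    then show ?thesis by (simp only: PS_flow_def prod.case e if_False) simp
  qed
qed

lemma PS_flow_zero: "PS_flow n (\<lambda>_. 0) (\<lambda>_. 0) e = 0"
  by (cases e) (simp add: PS_flow_def)

lemma PS_flow_sum:
  "(\<Sum>j<k. t j * PS_flow n (\<lambda>_. 0) (y j) e) = PS_flow n (\<lambda>_. 0) (\<lambda>l. \<Sum>j<k. t j * y j l) e"
  using PS_flow_linear[where A = "\<lambda>_. 0" and x = "\<lambda>_. 0" and t = t and y = y and n = n and k = k and e = e] by (simp add: PS_flow_zero)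

section \<open>Net flow and its partial sums\<close>

lemma netflow_PS:
  assumes "1 \<le> v"
  shows "netflow (PS (Suc (Suc n))) b v =
    (if v \<le> Suc n then b (v, Suc v) else 0) - (if 2 \<le> v \<and> v \<le> Suc (Suc n) then b (v - 1, v) else 0) +
    (if v \<le> n then b (v, Suc (Suc n)) else 0) - (if v = Suc (Suc n) then (\<Sum>i=Suc 0..n. b (i, Suc (Suc n))) else 0)"
proof -
  have 1: "(\<Sum>i=Suc 0..Suc n. b (i, Suc i) * of_bool (v = i)) = (if v \<le> Suc n then b (v, Suc v) else 0)"
    using assms by (simp add: of_bool_def if_distrib cong: if_cong)
  \<comment> \<open>Vertex 1 has no incoming spine edge: for \<open>v = 1\<close> the index
    \<open>v - 1 = 0\<close> lies outside the range of summation.\<close>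
  have "(\<Sum>i=Suc 0..Suc n. b (i, Suc i) * of_bool (v = Suc i)) =
      (\<Sum>i=Suc 0..Suc n. if i = v - 1 then b (v - 1, v) else 0)"
    using assms by (intro sum.cong) auto
  also have "\<dots> = (if 2 \<le> v \<and> v \<le> Suc (Suc n) then b (v - 1, v) else 0)"
    using assms by (subst sum.delta) auto
  finally have 2: "(\<Sum>i=Suc 0..Suc n. b (i, Suc i) * of_bool (v = Suc i)) = \<dots>" .
  have 3: "(\<Sum>i=Suc 0..n. b (i, Suc (Suc n)) * of_bool (v = i)) = (if v \<le> n then b (v, Suc (Suc n)) else 0)"
    using assms by (simp add: of_bool_def if_distrib cong: if_cong)
  have 4: "(\<Sum>i=Suc 0..n. b (i, Suc (Suc n)) * of_bool (v = Suc (Suc n))) =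
      (if v = Suc (Suc n) then (\<Sum>i=Suc 0..n. b (i, Suc (Suc n))) else 0)"
    by simp
  show ?thesis
    unfolding netflow_def sum_PS prod.case right_diff_distrib sum_subtractf 1 2 3 4 by simp
qed

text \<open>A cut argument: the edges leaving the first \<open>m\<close> vertices are one spine edge
  and the spokes starting there. Vertex \<open>Suc n\<close> starts no spoke, hence
  \<open>min m n\<close>.\<close>

lemma sum_netflow_PS:
  assumes "1 \<le> m" "m \<le> Suc n"
  shows "(\<Sum>v=Suc 0..m. netflow (PS (Suc (Suc n))) b v) = b (m, Suc m) + sum (spokes n b) {..<min m n}"
  using assms
proof (induction m rule: dec_induct)
  case base
  then show ?case by (cases n) (simp_all add: netflow_PS[of "Suc 0"])
next
  case (step m)
  then have "(\<Sum>v=Suc 0..Suc m. netflow (PS (Suc (Suc n))) b v) =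
      b (m, Suc m) + sum (spokes n b) {..<min m n} + netflow (PS (Suc (Suc n))) b (Suc m)"
    by simp
  also have "\<dots> = b (Suc m, Suc (Suc m)) + sum (spokes n b) {..<min (Suc m) n}"
    using step by (auto simp: netflow_PS min_def le_Suc_eq)
  finally show ?case .
qed

text \<open>Whatever leaves the first \<open>Suc n\<close> vertices enters the sink.\<close>

lemma sum_netflow_PS_total: "(\<Sum>v=Suc 0..Suc (Suc n). netflow (PS (Suc (Suc n))) b v) = 0"
proof -
  have "(\<Sum>v=Suc 0..Suc (Suc n). netflow (PS (Suc (Suc n))) b v) =
      (\<Sum>v=Suc 0..Suc n. netflow (PS (Suc (Suc n))) b v) + netflow (PS (Suc (Suc n))) b (Suc (Suc n))"
    by simp
  also have "\<dots> = sum (spokes n b) {..<n} - (\<Sum>i=Suc 0..n. b (i, Suc (Suc n)))"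
    by (subst sum_netflow_PS) (simp_all add: netflow_PS)
  also have "(\<Sum>i=Suc 0..n. b (i, Suc (Suc n))) = sum (spokes n b) {..<n}"
    by (simp add: sum.atLeast1_atMost_eq)
  finally show ?thesis by simp
qed

text \<open>By the cut identity, prescribing the partial sums of the net flow fixes each spine entry
  in terms of the spokes and leaves the spokes free. The zero total takes care of the sink.\<close>

lemma netflow_PS_iff:
  assumes total: "(\<Sum>v=Suc 0..Suc (Suc n). h v) = 0"
  shows "(\<forall>e. e \<notin> PS (Suc (Suc n)) \<longrightarrow> b e = 0) \<and> (\<forall>v\<in>{Suc 0..Suc (Suc n)}. netflow (PS (Suc (Suc n))) b v = h v) \<longleftrightarrow>
    b = PS_flow n (\<lambda>i. \<Sum>v=Suc 0..i. h v) (spokes n b)"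
    (is "?supp \<and> ?flow \<longleftrightarrow> b = ?b")
proof
  assume L: "?supp \<and> ?flow"
  have eq: "b (i, j) = ?b (i, j)" for i j
  proof (cases "(i, j) \<in> PS (Suc (Suc n))")
    case True
    then consider "1 \<le> i" "i \<le> Suc n" "j = Suc i" | "1 \<le> i" "i \<le> n" "j = Suc (Suc n)"
      by (auto simp: PS_eq)
    then show ?thesis
    proof cases
      case 1
      have "(\<Sum>v=Suc 0..i. h v) = (\<Sum>v=Suc 0..i. netflow (PS (Suc (Suc n))) b v)"
        using L 1 by (intro sum.cong) auto
      then show ?thesis using 1 sum_netflow_PS[of i n b] by (simp add: PS_flow_def)
    next
      case 2
      then show ?thesis by (simp add: PS_flow_def)
    qed
  next
    case False
    then show ?thesis using L PS_flow_outside by simp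
  qed
  show "b = ?b"
  proof
    show "b e = ?b e" for e using eq[of "fst e" "snd e"] unfolding prod.collapse .
  qed
next
  assume b: "b = ?b"
  have ?supp using PS_flow_outside[of _ n] by (subst b) blast
  have part: "(\<Sum>v=Suc 0..m. netflow (PS (Suc (Suc n))) b v) = (\<Sum>v=Suc 0..m. h v)" if "m \<le> Suc (Suc n)" for m
  proof -
    consider "m = 0" | "1 \<le> m" "m \<le> Suc n" | "m = Suc (Suc n)" using \<open>m \<le> Suc (Suc n)\<close> by linarith
    then show ?thesis
    proof cases
      case 2
      have "b (m, Suc m) = (\<Sum>v=Suc 0..m. h v) - sum (spokes n b) {..<min m n}"
        using 2 by (subst b) (simp add: PS_flow_def)
      then show ?thesis using sum_netflow_PS[OF 2, of b] by linarith
    next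
      case 3
      then show ?thesis using total sum_netflow_PS_total by simp
    qed simp
  qed
  have ?flow
  proof
    \<comment> \<open>The net flow at a vertex is recovered as the difference of two consecutive
      partial sums.\<close>
    fix v assume v: "v \<in> {Suc 0..Suc (Suc n)}"
    then obtain m where m: "v = Suc m" by (cases v) auto
    then show "netflow (PS (Suc (Suc n))) b v = h v"
      using part[of m] part[of v] v by simp
  qed
  with \<open>?supp\<close> show "?supp \<and> ?flow" ..
qed

lemma flow_space_PS:
  assumes as: "length as = Suc n"
  shows "b \<in> flow_space (PS (Suc (Suc n))) as \<longleftrightarrow>
    b = PS_flow n (\<lambda>i. of_int (sum_list (take i as))) (spokes n b)"
proof -
  let ?h = "\<lambda>v. real_of_int ((as @ [- sum_list as]) ! (v - 1))"
  have part: "(\<Sum>v=Suc 0..i. ?h v) = of_int (sum_list (take i (as @ [- sum_list as])))" if "i \<le> Suc (Suc n)" for i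
    using that
  proof (induction i)
    case (Suc i)
    then have "take (Suc i) (as @ [- sum_list as]) =
        take i (as @ [- sum_list as]) @ [(as @ [- sum_list as]) ! i]"
      using as by (intro take_Suc_conv_app_nth) simp
    then show ?case using Suc by simp
  qed simp
  have "(\<Sum>v=Suc 0..Suc (Suc n). ?h v) = 0"
    using part[of "Suc (Suc n)"] as by simp
  from netflow_PS_iff[OF this, of b]
  have "b \<in> flow_space (PS (Suc (Suc n))) as \<longleftrightarrow> b = PS_flow n (\<lambda>i. \<Sum>v=Suc 0..i. ?h v) (spokes n b)"
    unfolding flow_space_def using as by simp
  also have "PS_flow n (\<lambda>i. \<Sum>v=Suc 0..i. ?h v) (spokes n b) =
      PS_flow n (\<lambda>i. of_int (sum_list (take i as))) (spokes n b)"
  proof (rule PS_flow_cong)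
    fix i assume "i \<le> Suc n"
    then show "(\<Sum>v = Suc 0..i. ?h v) = of_int (sum_list (take i as))"
      using as by (subst part) auto
  qed simp
  finally show ?thesis .
qed

section \<open>The circulation lattice and its bases\<close>

lemma circulation_lattice_PS:
  "b \<in> circulation_lattice (Suc n) (PS (Suc (Suc n))) \<longleftrightarrow>
    b = PS_flow n (\<lambda>_. 0) (spokes n b) \<and> (\<forall>l<n. spokes n b l \<in> \<int>)"
proof -
  \<comment> \<open>With zero net flow the spine entries are negated sums of spokes, so integral
    spokes force all entries to be integral.\<close>
  have int: "PS_flow n (\<lambda>_. 0) x e \<in> \<int>" if "\<forall>l<n. x l \<in> \<int>" for x e
    using that by (cases e) (auto simp: PS_flow_def intro!: Ints_sum)
  have "b \<in> circulation_lattice (Suc n) (PS (Suc (Suc n))) \<longleftrightarrow>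
      b = PS_flow n (\<lambda>_. 0) (spokes n b) \<and> (\<forall>e. b e \<in> \<int>)"
    unfolding circulation_lattice_def using netflow_PS_iff[of "\<lambda>_. 0" n b] by auto
  also have "\<dots> \<longleftrightarrow> b = PS_flow n (\<lambda>_. 0) (spokes n b) \<and> (\<forall>l<n. spokes n b l \<in> \<int>)"
    using int by metis
  finally show ?thesis .
qed

lemma PS_flow_in_circulation_lattice:
  assumes "\<forall>l<n. x l \<in> \<int>"
  shows "PS_flow n (\<lambda>_. 0) x \<in> circulation_lattice (Suc n) (PS (Suc (Suc n)))"
proof -
  have "PS_flow n (\<lambda>_. 0) x = PS_flow n (\<lambda>_. 0) (spokes n (PS_flow n (\<lambda>_. 0) x))"
    by (rule PS_flow_cong) (simp_all add: PS_flow_spoke)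
  then show ?thesis using assms by (simp add: circulation_lattice_PS PS_flow_spoke)
qed

text \<open>Needed because \<open>normalized_volume\<close> picks its basis by
  \<open>SOME\<close>.\<close>

lemma ex_lattice_basis_PS:
  "\<exists>w. lattice_basis (circulation_lattice (Suc n) (PS (Suc (Suc n)))) n w"
proof -
  \<comment> \<open>The cycle closed by spoke \<open>i\<close>: 1 on the spoke and -1 on every spine
    edge from vertex \<open>Suc i\<close> to the sink.\<close>
  let ?w = "\<lambda>i. PS_flow n (\<lambda>_. 0) (\<lambda>l. of_bool (l = i))"
  have comb: "(\<lambda>e. \<Sum>i<n. of_int (c i) * ?w i e) = PS_flow n (\<lambda>_. 0) (\<lambda>l. of_int (c l))" for c :: "nat \<Rightarrow> int"
  proof
    fix e
    have "(\<Sum>i<n. of_int (c i) * ?w i e) =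
        PS_flow n (\<lambda>_. 0) (\<lambda>l. \<Sum>i<n. of_int (c i) * of_bool (l = i)) e"
      by (rule PS_flow_sum)
    also have "PS_flow n (\<lambda>_. 0) (\<lambda>l. \<Sum>i<n. of_int (c i) * of_bool (l = i)) =
        PS_flow n (\<lambda>_. 0) (\<lambda>l. of_int (c l))"
      by (intro PS_flow_cong) (auto simp: of_bool_def if_distrib cong: if_cong)
    finally show "(\<Sum>i<n. of_int (c i) * ?w i e) = PS_flow n (\<lambda>_. 0) (\<lambda>l. of_int (c l)) e" .
  qed
  have "circulation_lattice (Suc n) (PS (Suc (Suc n))) =
      range (\<lambda>c :: nat \<Rightarrow> int. PS_flow n (\<lambda>_. 0) (\<lambda>l. of_int (c l)))"
  proof (intro equalityI subsetI)
    fix b assume "b \<in> circulation_lattice (Suc n) (PS (Suc (Suc n)))"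
    then have b: "b = PS_flow n (\<lambda>_. 0) (spokes n b)" and int: "\<forall>l<n. spokes n b l \<in> \<int>"
      by (auto simp: circulation_lattice_PS)
    note b
    also have "PS_flow n (\<lambda>_. 0) (spokes n b) = PS_flow n (\<lambda>_. 0) (\<lambda>l. of_int \<lfloor>spokes n b l\<rfloor>)"
      using int by (intro PS_flow_cong) (auto simp: of_int_floor)
    finally show "b \<in> range (\<lambda>c :: nat \<Rightarrow> int. PS_flow n (\<lambda>_. 0) (\<lambda>l. of_int (c l)))"
      by (rule range_eqI[where f = "\<lambda>c. PS_flow n (\<lambda>_. 0) (\<lambda>l. of_int (c l))"])
  qed (auto intro!: PS_flow_in_circulation_lattice)
  moreover have "c i = 0" if "\<forall>e. PS_flow n (\<lambda>_. 0) (\<lambda>l. of_int (c l)) e = 0" "i < n" for c :: "nat \<Rightarrow> int" and i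
    using that(1) PS_flow_spoke[OF that(2), of "\<lambda>_. 0" "\<lambda>l. of_int (c l)"] by simp
  ultimately have "lattice_basis (circulation_lattice (Suc n) (PS (Suc (Suc n)))) n ?w"
    unfolding lattice_basis_def comb[unfolded fun_eq_iff, rule_format] by auto
  then show ?thesis by (intro exI[of _ ?w])
qed

lemma lattice_basis_mem:
  assumes "lattice_basis L k w" "j < k"
  shows "w j \<in> L"
proof -
  have "w j = (\<lambda>(c :: nat \<Rightarrow> int) e. \<Sum>i<k. of_int (c i) * w i e) (\<lambda>i. if i = j then 1 else 0)"
    using assms(2) by (simp add: if_distrib if_distribR cong: if_cong)
  then have "w j \<in> range (\<lambda>(c :: nat \<Rightarrow> int) e. \<Sum>i<k. of_int (c i) * w i e)"
    by (rule range_eqI[where x = "\<lambda>i. if i = j then 1 else 0"])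
  then show ?thesis using assms(1) unfolding lattice_basis_def by simp
qed

text \<open>Reading off the spokes identifies circulations with integer vectors, so the spokes of a
  lattice basis form an integral basis there: independence gives injectivity, generation gives
  surjectivity.\<close>

lemma lattice_automorphism_spokes:
  assumes basis: "lattice_basis (circulation_lattice (Suc n) (PS (Suc (Suc n)))) n w"
  shows "lattice_automorphism {..<n} (\<lambda>j. spokes n (w j))"
proof
  let ?W = "\<lambda>j. spokes n (w j)" and ?Z = "\<Pi>\<^sub>E i\<in>{..<n}. (\<int> :: real set)"
  let ?T = "linear_apply {..<n} ?W"
  have w: "w j = PS_flow n (\<lambda>_. 0) (?W j)" "\<forall>l<n. ?W j l \<in> \<int>" if "j < n" for j
    using lattice_basis_mem[OF basis that] by (auto simp: circulation_lattice_PS)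
  show "bij_betw ?T ?Z ?Z"
  proof (rule bij_betw_imageI)
    show "inj_on ?T ?Z"
    proof
      fix x y assume x: "x \<in> ?Z" and y: "y \<in> ?Z" and eq: "?T x = ?T y"
      \<comment> \<open>Independence in \<open>lattice_basis\<close> speaks of coefficients of type
        \<open>int\<close>, so the integral difference is converted by the floor.\<close>
      define c where "c j = \<lfloor>x j - y j\<rfloor>" for j
      have c: "of_int (c j) = x j - y j" if "j < n" for j
        using that x y by (auto simp: c_def PiE_iff intro!: of_int_floor)
      have "(\<Sum>j<n. of_int (c j) * w j e) = 0" for e
      proof -
        have "(\<Sum>j<n. of_int (c j) * w j e) = (\<Sum>j<n. of_int (c j) * PS_flow n (\<lambda>_. 0) (?W j) e)"
          using w(1) by (intro sum.cong) (auto dest: fun_cong[of _ _ e])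
        also have "\<dots> = PS_flow n (\<lambda>_. 0) (\<lambda>l. \<Sum>j<n. of_int (c j) * ?W j l) e"
          by (rule PS_flow_sum)
        also have "PS_flow n (\<lambda>_. 0) (\<lambda>l. \<Sum>j<n. of_int (c j) * ?W j l) = PS_flow n (\<lambda>_. 0) (\<lambda>_. 0)"
        proof (rule PS_flow_cong[OF refl])
          fix l assume "l < n"
          have "(\<Sum>j<n. of_int (c j) * ?W j l) = (\<Sum>j<n. x j * ?W j l) - (\<Sum>j<n. y j * ?W j l)"
            by (simp add: c left_diff_distrib sum_subtractf)
          then show "(\<Sum>j<n. of_int (c j) * ?W j l) = 0"
            using fun_cong[OF eq, of l] \<open>l < n\<close> by (simp add: linear_apply_def)
        qed
        finally show ?thesis by (simp add: PS_flow_zero)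
      qed
      then have "\<forall>i<n. c i = 0" using basis unfolding lattice_basis_def by blast
      then have "x i = y i" if "i < n" for i using c[OF that] that by simp
      then show "x = y" using x y by (intro PiE_ext) auto
    qed
    show "?T ` ?Z = ?Z"
    proof (intro equalityI subsetI)
      fix y assume "y \<in> ?T ` ?Z"
      then show "y \<in> ?Z"
        using w(2) by (auto simp: linear_apply_def PiE_iff intro!: Ints_sum Ints_mult)
    next
      fix y assume y: "y \<in> ?Z"
      then have "PS_flow n (\<lambda>_. 0) y \<in> circulation_lattice (Suc n) (PS (Suc (Suc n)))"
        by (intro PS_flow_in_circulation_lattice) (auto simp: PiE_iff)
      then obtain c :: "nat \<Rightarrow> int" where c: "PS_flow n (\<lambda>_. 0) y = (\<lambda>e. \<Sum>i<n. of_int (c i) * w i e)"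
        using basis unfolding lattice_basis_def by blast
      have "?T (\<lambda>i\<in>{..<n}. of_int (c i)) = y"
      proof (rule PiE_ext[of _ "{..<n}" "\<lambda>_. UNIV"])
        fix i assume i: "i \<in> {..<n}"
        then have "y i = (\<Sum>j<n. of_int (c j) * ?W j i)"
          using PS_flow_spoke[of i n "\<lambda>_. 0" y] c by simp
        then show "?T (\<lambda>i\<in>{..<n}. of_int (c i)) i = y i" using i by (simp add: linear_apply_def)
      qed (use y in \<open>auto simp: linear_apply_def PiE_iff\<close>)
      then show "y \<in> ?T ` ?Z" by (intro image_eqI[of _ _ "\<lambda>i\<in>{..<n}. of_int (c i)"]) auto
    qed
  qed
qed simp

section \<open>Volume of the set of vectors with bounded partial sums\<close>

lemma measurable_sum_coords:
  fixes k :: nat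
  assumes "S \<subseteq> {..<k}"
  shows "(\<lambda>x. sum x S) \<in> borel_measurable (\<Pi>\<^sub>M i\<in>{..<k}. (lborel :: real measure))"
proof (rule borel_measurable_sum)
  show "(\<lambda>x. x i) \<in> borel_measurable (\<Pi>\<^sub>M i\<in>{..<k}. (lborel :: real measure))" if "i \<in> S" for i
    using measurable_component_singleton[of i "{..<k}" "\<lambda>_. lborel :: real measure"] that assms
    by auto
qed

lemma measurable_partial_sums_bounded:
  fixes k :: nat
  shows "Measurable.pred (\<Pi>\<^sub>M i\<in>{..<k}. (lborel :: real measure))
     (\<lambda>x. \<forall>i<k. 0 \<le> x i \<and> sum x {..i} \<le> A i)"
proof -
  let ?M = "\<Pi>\<^sub>M i\<in>{..<k}. (lborel :: real measure)"
  have "Measurable.pred ?M (\<lambda>x. \<forall>i\<in>{..<k}. 0 \<le> x i \<and> sum x {..i} \<le> A i)"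
  proof (rule pred_intros_finite(3))
    fix i assume i: "i \<in> {..<k}"
    then have "{i} \<subseteq> {..<k}" "{..i} \<subseteq> {..<k}" by auto
    then have [measurable]: "(\<lambda>x. x i) \<in> borel_measurable ?M" "(\<lambda>x. sum x {..i}) \<in> borel_measurable ?M"
      using measurable_sum_coords[of "{i}" k] measurable_sum_coords[of "{..i}" k] by simp_all
    show "Measurable.pred ?M (\<lambda>x. 0 \<le> x i \<and> sum x {..i} \<le> A i)"
      by measurable
  qed simp
  then show ?thesis by (simp add: Ball_def)
qed

text \<open>
  The functions \<open>f i\<close> are Goncarov polynomials up to sign: \<open>f i s\<close> is the volume of the set of
  admissible continuations \<open>x\<^sub>i, \<dots>, x\<^bsub>n-1\<^esub>\<close> once \<open>x\<^sub>0 + \<dots> + x\<^bsub>i-1\<^esub> = s\<close>.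
\<close>

locale goncarov =
  fixes n :: nat and A :: "nat \<Rightarrow> real" and f :: "nat \<Rightarrow> real \<Rightarrow> real"
  assumes mono: "\<And>i. Suc i < n \<Longrightarrow> A i \<le> A (Suc i)" and A0: "0 \<le> A 0"
    and deriv: "\<And>i s. i < n \<Longrightarrow> (f i has_real_derivative - f (Suc i) s) (at s)"
    and zero: "\<And>i. i < n \<Longrightarrow> f i (A i) = 0" and last: "\<And>s. f n s = 1"
begin

text \<open>Downward induction: up to its zero \<open>A i\<close> the function \<open>f i\<close> is
  nonincreasing, since its derivative is \<open>- f (Suc i)\<close> and that range lies below
  \<open>A (Suc i)\<close> by monotonicity.\<close>

lemma nonneg:
  assumes "i \<le> n" "i < n \<Longrightarrow> s \<le> A i"
  shows "0 \<le> f i s"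
  using assms
proof (induction i arbitrary: s rule: inc_induct)
  case base
  then show ?case by (simp add: last)
next
  case (step i)
  have "f i (A i) \<le> f i s"
  proof (rule DERIV_nonpos_imp_nonincreasing[of s "A i" "f i"])
    show "s \<le> A i" using step by simp
    fix x assume "s \<le> x" "x \<le> A i"
    then have "x \<le> A (Suc i)" if "Suc i < n" using mono[OF that] by simp
    then have "0 \<le> f (Suc i) x" using step by simp
    then show "\<exists>y. (f i has_real_derivative y) (at x) \<and> y \<le> 0"
      using deriv[of i x] step by (intro exI[of _ "- f (Suc i) x"]) simp
  qed
  then show ?case using zero[of i] step by simp
qed

lemma measurable: "i \<le> n \<Longrightarrow> f i \<in> borel_measurable borel"
proof (cases "i = n")
  case True
  then have "f i = (\<lambda>_. 1)" using last by auto
  then show ?thesis by simp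
next
  case False
  assume "i \<le> n"
  then have "isCont (f i) s" for s using deriv[of i s] False by (intro DERIV_isCont) auto
  then show ?thesis
    by (intro borel_measurable_continuous_onI continuous_at_imp_continuous_on) auto
qed

text \<open>The fundamental theorem of calculus on \<open>{0..A i - S}\<close>: the antiderivative
  \<open>- f i (S + y)\<close> vanishes at the upper end.\<close>

lemma integral_last_coordinate:
  assumes i: "i < n" and S: "S \<le> A i"
  shows "(\<integral>\<^sup>+y. of_bool (0 \<le> y \<and> S + y \<le> A i) * ennreal (f (Suc i) (S + y)) \<partial>lborel) =
    ennreal (f i S)"
proof -
  have "(\<integral>\<^sup>+y. of_bool (0 \<le> y \<and> S + y \<le> A i) * ennreal (f (Suc i) (S + y)) \<partial>lborel) =
      (\<integral>\<^sup>+y. ennreal (f (Suc i) (S + y)) * indicator {0..A i - S} y \<partial>lborel)"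
    by (intro nn_integral_cong) (auto simp: indicator_def)
  also have "\<dots> = ennreal (- f i (S + (A i - S)) - - f i (S + 0))"
  proof (rule nn_integral_FTC_Icc)
    have [measurable]: "f (Suc i) \<in> borel_measurable borel" using measurable[of "Suc i"] i by simp
    show "(\<lambda>y. f (Suc i) (S + y)) \<in> borel_measurable borel" by measurable
    fix y assume y: "y \<in> {0..A i - S}"
    have "((\<lambda>y. f i (S + y)) has_real_derivative - f (Suc i) (S + y)) (at y)"
      using deriv[OF i, of "y + S"] unfolding DERIV_shift by (simp add: add.commute)
    then show "((\<lambda>y. - f i (S + y)) has_real_derivative f (Suc i) (S + y)) (at y)"
      using DERIV_minus by fastforce
    have "S + y \<le> A (Suc i)" if "Suc i < n" using mono[OF that] y by simp
    then show "0 \<le> f (Suc i) (S + y)" using i by (intro nonneg) auto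
  qed (use S in auto)
  also have "\<dots> = ennreal (f i S)" using zero[OF i] by simp
  finally show ?thesis .
qed

text \<open>The value is the same for all \<open>m\<close>: Fubini splits off coordinate
  \<open>m\<close>, and integrating it out turns \<open>f (Suc m)\<close> into
  \<open>f m\<close>.\<close>

lemma integral_partial_sums_bounded:
  assumes "m \<le> n"
  shows "(\<integral>\<^sup>+x. of_bool (\<forall>i<m. 0 \<le> x i \<and> sum x {..i} \<le> A i) * ennreal (f m (sum x {..<m}))
      \<partial>(\<Pi>\<^sub>M i\<in>{..<m}. lborel)) = ennreal (f 0 0)"
  using assms
proof (induction m)
  case 0
  show ?case by (simp add: space_PiM)
next
  case (Suc m)
  let ?P = "\<lambda>m x. \<forall>i<m. 0 \<le> x i \<and> sum x {..i} \<le> A i"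
  let ?M = "\<lambda>m. \<Pi>\<^sub>M i\<in>{..<m}. (lborel :: real measure)"
  have "(\<lambda>x. ennreal (f (Suc m) (sum x {..<Suc m}))) \<in> borel_measurable (?M (Suc m))"
    using Suc.prems
    by (intro measurable_compose[OF measurable_compose[OF measurable_sum_coords measurable] measurable_ennreal]) auto
  moreover have "(\<lambda>x. of_bool (?P (Suc m) x) :: ennreal) \<in> borel_measurable (?M (Suc m))"
    by (rule measurable_compose[OF measurable_partial_sums_bounded]) simp
  ultimately have g: "(\<lambda>x. of_bool (?P (Suc m) x) * ennreal (f (Suc m) (sum x {..<Suc m})))
      \<in> borel_measurable (?M (Suc m))"
    by (rule borel_measurable_times_ennreal[rotated])
  have "(\<integral>\<^sup>+x. of_bool (?P (Suc m) x) * ennreal (f (Suc m) (sum x {..<Suc m})) \<partial>?M (Suc m)) =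
     (\<integral>\<^sup>+x. \<integral>\<^sup>+y. of_bool (?P (Suc m) (x(m := y))) *
        ennreal (f (Suc m) (sum (x(m := y)) {..<Suc m})) \<partial>lborel \<partial>?M m)"
    using g unfolding lessThan_Suc
    by (rule lborel_product.product_nn_integral_insert[OF finite_lessThan, rotated]) simp
  also have "\<dots> = (\<integral>\<^sup>+x. of_bool (?P m x) * ennreal (f m (sum x {..<m})) \<partial>?M m)"
  proof (rule nn_integral_cong)
    fix x :: "nat \<Rightarrow> real"
    let ?S = "sum x {..<m}"
    have sum_upd: "sum (x(m := y)) {..i} = sum x {..i}" if "i < m" for y i
      using that by (intro sum.cong) auto
    have sum_upd': "sum (x(m := y)) {..<m} = ?S" for y
      by (intro sum.cong) auto
    have P: "?P (Suc m) (x(m := y)) \<longleftrightarrow> ?P m x \<and> 0 \<le> y \<and> ?S + y \<le> A m" for y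
      by (auto simp: less_Suc_eq all_conj_distrib sum_upd lessThan_Suc_atMost[symmetric] sum_upd'
          simp del: fun_upd_apply) (auto simp: fun_upd_apply)
    have "(\<integral>\<^sup>+y. of_bool (?P (Suc m) (x(m := y))) *
        ennreal (f (Suc m) (sum (x(m := y)) {..<Suc m})) \<partial>lborel) =
      (\<integral>\<^sup>+y. of_bool (?P m x) * (of_bool (0 \<le> y \<and> ?S + y \<le> A m) * ennreal (f (Suc m) (?S + y))) \<partial>lborel)"
      unfolding P by (intro nn_integral_cong) (simp add: sum_upd')
    also have "\<dots> = of_bool (?P m x) * ennreal (f m ?S)"
    proof (cases "?P m x")
      case True
      \<comment> \<open>The interval for the new coordinate must be nonempty; this follows from the
        preceding bound and monotonicity, or from \<open>A0\<close> at the start.\<close>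
      have "?S \<le> A m"
      proof (cases m)
        case 0
        then show ?thesis using A0 by simp
      next
        case (Suc k)
        then have "?S \<le> A k" using True by (simp add: lessThan_Suc_atMost)
        also have "A k \<le> A m" using mono[of k] Suc Suc.prems by simp
        finally show ?thesis .
      qed
      then show ?thesis using True integral_last_coordinate[of m ?S] Suc.prems by simp
    qed auto
    finally show "(\<integral>\<^sup>+y. of_bool (?P (Suc m) (x(m := y))) *
        ennreal (f (Suc m) (sum (x(m := y)) {..<Suc m})) \<partial>lborel) = \<dots>" .
  qed
  also have "\<dots> = ennreal (f 0 0)" using Suc by simp
  finally show ?case .
qed

lemma volume:
  "(\<integral>\<^sup>+x. of_bool (\<forall>i<n. 0 \<le> x i \<and> sum x {..i} \<le> A i) \<partial>(\<Pi>\<^sub>M i\<in>{..<n}. lborel)) = ennreal (f 0 0)"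
  using integral_partial_sums_bounded[of n] by (simp add: last)

end

section \<open>The normalized volume\<close>

text \<open>Nonnegative spine entries are the bounds on partial sums. The last spine edge has the
  same partial sum as the one before it and a bound at least as large, so it adds no
  condition.\<close>

lemma PS_flow_mem_flow_polytope:
  fixes as :: "int list"
  defines "A \<equiv> \<lambda>i. real_of_int (sum_list (take i as))"
  assumes as: "length as = Suc n" and mono: "A n \<le> A (Suc n)"
  shows "PS_flow n A x \<in> flow_polytope (PS (Suc (Suc n))) as \<longleftrightarrow>
    (\<forall>i<n. 0 \<le> x i \<and> sum x {..i} \<le> A (Suc i))"
proof -
  have "PS_flow n A x = PS_flow n A (spokes n (PS_flow n A x))"
    by (rule PS_flow_cong) (simp_all add: PS_flow_spoke)
  then have "PS_flow n A x \<in> flow_space (PS (Suc (Suc n))) as"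
    unfolding flow_space_PS[OF as] A_def .
  then have "PS_flow n A x \<in> flow_polytope (PS (Suc (Suc n))) as \<longleftrightarrow>
      (\<forall>e\<in>PS (Suc (Suc n)). 0 \<le> PS_flow n A x e)"
    by (simp add: flow_polytope_def)
  also have "\<dots> \<longleftrightarrow> (\<forall>i\<in>{Suc 0..Suc n}. sum x {..<min i n} \<le> A i) \<and> (\<forall>i<n. 0 \<le> x i)"
  proof -
    have "(\<forall>i\<in>{Suc 0..Suc n}. 0 \<le> PS_flow n A x (i, Suc i)) \<longleftrightarrow>
        (\<forall>i\<in>{Suc 0..Suc n}. sum x {..<min i n} \<le> A i)"
      by (intro ball_cong) (auto simp: PS_flow_def)
    moreover have "(\<forall>i\<in>{Suc 0..n}. 0 \<le> PS_flow n A x (i, Suc (Suc n))) \<longleftrightarrow> (\<forall>i<n. 0 \<le> x i)"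
    proof -
      have "{Suc 0..n} = Suc ` {..<n}" by (simp add: image_Suc_lessThan)
      then show ?thesis by (auto simp: PS_flow_spoke)
    qed
    ultimately show ?thesis
      by (simp add: PS_eq ball_Un)
  qed
  also have "\<dots> \<longleftrightarrow> (\<forall>i<n. 0 \<le> x i \<and> sum x {..i} \<le> A (Suc i))"
  proof -
    have "(\<forall>i\<in>{Suc 0..Suc n}. sum x {..<min i n} \<le> A i) \<longleftrightarrow> (\<forall>i<n. sum x {..i} \<le> A (Suc i))"
    proof (intro iffI allI ballI impI)
      fix i assume *: "\<forall>i\<in>{Suc 0..Suc n}. sum x {..<min i n} \<le> A i" and "i < n"
      then show "sum x {..i} \<le> A (Suc i)"
        using bspec[OF *, of "Suc i"] by (simp add: min_absorb1 lessThan_Suc_atMost)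
    next
      fix i assume *: "\<forall>i<n. sum x {..i} \<le> A (Suc i)" and i: "i \<in> {Suc 0..Suc n}"
      \<comment> \<open>The case \<open>k = 0\<close> occurs for \<open>n = 0\<close>, where the
        empty sum meets \<open>A 0 = 0\<close>.\<close>
      have le: "sum x {..<k} \<le> A k" if "k \<le> n" for k
        using that * by (cases k) (auto simp: A_def lessThan_Suc_atMost)
      show "sum x {..<min i n} \<le> A i"
      proof (cases "i \<le> n")
        case False
        then have "i = Suc n" using i by simp
        then show ?thesis using le[of n] mono by simp
      qed (use le[of i] in simp)
    qed
    then show ?thesis by blast
  qed
  finally show ?thesis .
qed

text \<open>
  In the coordinates of an arbitrary lattice basis the polytope is the preimage, under a lattice
  automorphism followed by a translation, of the polytope in the coordinates given by the spokes.
\<close>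

lemma emeasure_lattice_coords_PS:
  fixes as :: "int list"
  defines "A \<equiv> \<lambda>i. real_of_int (sum_list (take i as))"
  assumes as: "length as = Suc n" and mono: "A n \<le> A (Suc n)"
    and p: "p \<in> flow_space (PS (Suc (Suc n))) as"
    and basis: "lattice_basis (circulation_lattice (Suc n) (PS (Suc (Suc n)))) n w"
  shows "emeasure (\<Pi>\<^sub>M i\<in>{..<n}. lborel) (lattice_coords n p w (flow_polytope (PS (Suc (Suc n))) as)) =
    (\<integral>\<^sup>+x. of_bool (\<forall>i<n. 0 \<le> x i \<and> sum x {..i} \<le> A (Suc i)) \<partial>(\<Pi>\<^sub>M i\<in>{..<n}. lborel))"
proof -
  let ?M = "\<Pi>\<^sub>M i\<in>{..<n}. (lborel :: real measure)"
  let ?W = "\<lambda>j. spokes n (w j)" and ?R = "\<lambda>x. \<forall>i<n. 0 \<le> x i \<and> sum x {..i} \<le> A (Suc i)"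
  interpret lattice_automorphism "{..<n}" ?W
    using basis by (rule lattice_automorphism_spokes)
  let ?T = "linear_apply {..<n} ?W"
  define shift where "shift x = (\<lambda>i\<in>{..<n}. x i + spokes n p i)" for x
  have R: "Measurable.pred ?M ?R"
    by (rule measurable_partial_sums_bounded)
  have shift: "shift \<in> ?M \<rightarrow>\<^sub>M ?M"
    unfolding shift_def by (rule measurable_shift)
  have w: "w j = PS_flow n (\<lambda>_. 0) (?W j)" if "j < n" for j
    using lattice_basis_mem[OF basis that] unfolding circulation_lattice_PS by blast
  have p: "p = PS_flow n A (spokes n p)"
    using p unfolding flow_space_PS[OF as] A_def .
  have mem: "(\<lambda>e. p e + (\<Sum>i<n. t i * w i e)) \<in> flow_polytope (PS (Suc (Suc n))) as \<longleftrightarrow>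
      ?R (shift (?T t))" for t
  proof -
    have "(\<lambda>e. p e + (\<Sum>i<n. t i * w i e)) = PS_flow n A (shift (?T t))"
    proof
      fix e
      have "p e + (\<Sum>i<n. t i * w i e) =
          PS_flow n A (spokes n p) e + (\<Sum>i<n. t i * PS_flow n (\<lambda>_. 0) (?W i) e)"
        by (intro arg_cong2[of _ _ _ _ "(+)"] fun_cong[OF p] sum.cong[OF refl]
            arg_cong[of _ _ "(*) _"] fun_cong[OF w]) simp
      also have "\<dots> = PS_flow n A (\<lambda>l. spokes n p l + (\<Sum>j<n. t j * ?W j l)) e"
        by (rule PS_flow_linear)
      also have "PS_flow n A (\<lambda>l. spokes n p l + (\<Sum>j<n. t j * ?W j l)) = PS_flow n A (shift (?T t))"
        by (rule PS_flow_cong) (simp_all add: shift_def linear_apply_def)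
      finally show "p e + (\<Sum>i<n. t i * w i e) = PS_flow n A (shift (?T t)) e" .
    qed
    then show ?thesis
      using PS_flow_mem_flow_polytope[OF as mono[unfolded A_def], of "shift (?T t)"]
      unfolding A_def by simp
  qed
  have coords: "lattice_coords n p w (flow_polytope (PS (Suc (Suc n))) as) =
      {t \<in> space ?M. ?R (shift (?T t))}"
    unfolding lattice_coords_def mem by (simp add: space_PiM)
  have "{t \<in> space ?M. ?R (shift (?T t))} \<in> sets ?M"
    using measurable_compose[OF measurable_linear_apply measurable_compose[OF shift R]]
    by (rule predE)
  then have "emeasure ?M (lattice_coords n p w (flow_polytope (PS (Suc (Suc n))) as)) =
      (\<integral>\<^sup>+t. indicator {t \<in> space ?M. ?R (shift (?T t))} t \<partial>?M)"
    unfolding coords by (rule nn_integral_indicator[symmetric])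
  also have "\<dots> = (\<integral>\<^sup>+t. of_bool (?R (shift (?T t))) \<partial>?M)"
    by (intro nn_integral_cong) (simp add: indicator_def)
  also have "\<dots> = (\<integral>\<^sup>+t. of_bool (?R (shift t)) \<partial>?M)"
    by (rule nn_integral_linear_apply[of "\<lambda>t. of_bool (?R (shift t))"],
        rule measurable_compose[OF measurable_compose[OF shift R]]) simp
  also have "\<dots> = (\<integral>\<^sup>+t. of_bool (?R t) \<partial>?M)"
    unfolding shift_def
    by (rule nn_integral_PiM_lborel_translate[of _ "\<lambda>t. of_bool (?R t)"],
        simp, rule measurable_compose[OF R]) simp
  finally show ?thesis .
qed

text \<open>With \<open>2 * n + 1\<close> edges the dimension is \<open>n\<close>. Bounds in
  \<open>goncarov\<close> are counted from 0 and spine edges from 1, which explains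
  \<open>take (Suc i)\<close>.\<close>

lemma normalized_volume_PS:
  fixes as :: "int list"
  assumes as: "length as = Suc n" and as_nonneg: "\<forall>a\<in>set as. 0 \<le> a"
    and f: "goncarov n (\<lambda>i. of_int (sum_list (take (Suc i) as))) f"
  shows "normalized_volume (PS (n + 2)) as = fact n * f 0 0"
proof -
  let ?p = "SOME p. p \<in> flow_space (PS (Suc (Suc n))) as"
  let ?w = "SOME w. lattice_basis (circulation_lattice (Suc n) (PS (Suc (Suc n)))) n w"
  interpret goncarov n "\<lambda>i. of_int (sum_list (take (Suc i) as))" f by (rule f)
  \<comment> \<open>The flow with empty spokes shows that the affine space is inhabited, so the
    origin chosen by \<open>SOME\<close> lies in it.\<close>
  have "PS_flow n (\<lambda>i. of_int (sum_list (take i as))) (\<lambda>_. 0) \<in> flow_space (PS (Suc (Suc n))) as"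
    unfolding flow_space_PS[OF as] by (rule PS_flow_cong) (simp_all add: PS_flow_spoke)
  then have p: "?p \<in> flow_space (PS (Suc (Suc n))) as"
    by (rule someI[of "\<lambda>p. p \<in> flow_space (PS (Suc (Suc n))) as"])
  have w: "lattice_basis (circulation_lattice (Suc n) (PS (Suc (Suc n)))) n ?w"
    using ex_lattice_basis_PS by (rule someI_ex)
  \<comment> \<open>Monotonicity in \<open>goncarov\<close> stops at the sum of the first
    \<open>n\<close> entries; the last spine edge also involves entry \<open>n\<close>.\<close>
  have "sum_list (take (Suc n) as) = sum_list (take n as) + as ! n"
    using as by (subst take_Suc_conv_app_nth) simp_all
  moreover have "0 \<le> as ! n" using as_nonneg as by simp
  ultimately have mono: "real_of_int (sum_list (take n as)) \<le> real_of_int (sum_list (take (Suc n) as))"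
    by simp
  have "measure (\<Pi>\<^sub>M i\<in>{..<n}. lborel) (lattice_coords n ?p ?w (flow_polytope (PS (Suc (Suc n))) as)) = f 0 0"
    using emeasure_lattice_coords_PS[OF as mono p w] volume nonneg[of 0 0] A0
    by (simp add: measure_def)
  moreover have "card (PS (Suc (Suc n))) - Suc n = n"
    by (simp add: card_PS)
  ultimately show ?thesis
    by (simp add: normalized_volume_def as Let_def)
qed

section \<open>Closed forms for the net flow \<open>(a, b, c, d, ..., d)\<close>\<close>

lemma has_real_derivative_factor_power:
  "((\<lambda>s. (C - s) * (B - s) ^ Suc k) has_real_derivative
     - ((B - s) + real (Suc k) * (C - s)) * (B - s) ^ k) (at s)"
  by (rule derivative_eq_intros refl)+ (simp add: algebra_simps)

text \<open>One shape serves all non-affine cases: a linear correction for \<open>f 0\<close>, a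
  constant one (\<open>L = 0\<close>) for \<open>f 1\<close>, and none (\<open>K = L = 0\<close>)
  for later functions.\<close>

lemma has_real_derivative_goncarov_step:
  "((\<lambda>s. ((C - s) * (B - s) ^ Suc k - K - L * (a - s)) / D) has_real_derivative
     (L - ((B - s) + real (Suc k) * (C - s)) * (B - s) ^ k) / D) (at s)"
proof -
  have "((\<lambda>s. K + L * (a - s)) has_real_derivative - L) (at s)"
    by (rule derivative_eq_intros refl)+ simp
  from DERIV_cdivide[OF DERIV_diff[OF has_real_derivative_factor_power this], of C B k D]
  show ?thesis unfolding diff_diff_eq by (rule DERIV_cong) (simp add: algebra_simps)
qed

text \<open>With \<open>r = m + 2 - i\<close> and \<open>x\<close> the bound minus \<open>s\<close>,
  the pieces for \<open>i >= 2\<close> are the Abel polynomials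
  \<open>x * (x + r * d) ^ (r - 1) / fact r\<close>. For \<open>i = 1\<close> and
  \<open>i = 0\<close> the progression of bounds is continued backwards to \<open>e - d\<close> and
  \<open>e - 2 * d\<close>; the subtracted terms then move the zeros to \<open>a + b\<close> and
  \<open>a\<close>.\<close>

definition PS_goncarov :: "real \<Rightarrow> real \<Rightarrow> real \<Rightarrow> real \<Rightarrow> nat \<Rightarrow> nat \<Rightarrow> real \<Rightarrow> real" where
  "PS_goncarov a b c d m i s = (let e = a + b + c; B = e + real m * d in
     if i = 0 then ((e - 2 * d - s) * (B - s) ^ Suc m - (b + c - 2 * d) * (b + c + real m * d) ^ Suc m
       - real (m + 2) * (c - d) * (c + real m * d) ^ m * (a - s)) / fact (m + 2)
     else if i = 1 then ((e - d - s) * (B - s) ^ m - (c - d) * (c + real m * d) ^ m) / fact (m + 1)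
     else if i < m + 2 then (e + real (i - 2) * d - s) * (B - s) ^ (m + 1 - i) / fact (m + 2 - i)
     else 1)"

lemma goncarov_PS_goncarov:
  assumes "0 \<le> a" "0 \<le> b" "0 \<le> c" "0 \<le> d"
  shows "goncarov (m + 2) (\<lambda>i. if i = 0 then a else if i = 1 then a + b else a + b + c + real (i - 2) * d)
    (PS_goncarov a b c d m)"
proof
  let ?A = "\<lambda>i. if i = 0 then a else if i = 1 then a + b else a + b + c + real (i - 2) * d"
  let ?f = "PS_goncarov a b c d m"
  let ?e = "a + b + c" and ?B = "a + b + c + real m * d"
  show "?A i \<le> ?A (Suc i)" for i
    using assms by (auto simp: Suc_diff_le mult_right_mono)
  show "0 \<le> ?A 0" using assms by simp
  show "?f i (?A i) = 0" if "i < m + 2" for i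
    using that by (auto simp: PS_goncarov_def Let_def algebra_simps)
  show "?f (m + 2) s = 1" for s by (simp add: PS_goncarov_def)
  show "(?f i has_real_derivative - ?f (Suc i) s) (at s)" if i: "i < m + 2" for i s
  proof -
    \<comment> \<open>The cases follow the changes of formula between \<open>?f i\<close> and
      \<open>?f (Suc i)\<close>; in the second and fourth the next function is already the constant
      1.\<close>
    consider "i = 0" | "i = 1" "m = 0" | k where "i = 1" "m = Suc k"
      | "i = m + 1" "i \<ge> 2" | j k where "i = j + 2" "m = j + k + 2"
    proof -
      assume *: "i = 0 \<Longrightarrow> thesis" "i = 1 \<Longrightarrow> m = 0 \<Longrightarrow> thesis" "\<And>k. i = 1 \<Longrightarrow> m = Suc k \<Longrightarrow> thesis"
        "i = m + 1 \<Longrightarrow> i \<ge> 2 \<Longrightarrow> thesis" "\<And>j k. i = j + 2 \<Longrightarrow> m = j + k + 2 \<Longrightarrow> thesis"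
      show thesis
        using * (1,2) *(3)[of "m - 1"] *(4) *(5)[of "i - 2" "m - i"] i
        by (cases "i \<ge> 2"; cases "i = m + 1"; cases "i = 0"; cases "m = 0"; simp; linarith?)
    qed
    then show ?thesis
    proof cases
      case 1
      let ?L = "real (m + 2) * (c - d) * (c + real m * d) ^ m"
      have "?f 0 = (\<lambda>s. ((?e - 2 * d - s) * (?B - s) ^ Suc m - (b + c - 2 * d) * (b + c + real m * d) ^ Suc m
          - ?L * (a - s)) / fact (m + 2))"
        by (simp add: PS_goncarov_def Let_def fun_eq_iff)
      then have "(?f 0 has_real_derivative
          (?L - ((?B - s) + real (Suc m) * (?e - 2 * d - s)) * (?B - s) ^ m) / fact (m + 2)) (at s)"
        by (simp only: has_real_derivative_goncarov_step)
      \<comment> \<open>Since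
        \<open>?B - s + (m + 1) * (?e - 2 * d - s) = (m + 2) * (?e - d - s)\<close>, differentiation
        advances the bound by \<open>d\<close> and produces the factor that lowers the
        factorial.\<close>
      also have "(?L - ((?B - s) + real (Suc m) * (?e - 2 * d - s)) * (?B - s) ^ m) / fact (m + 2) =
          real (m + 2) * - ((?e - d - s) * (?B - s) ^ m - (c - d) * (c + real m * d) ^ m) / fact (m + 2)"
      proof -
        have "real (m + 2) * (c - d) * X - ((?B - s) + real (Suc m) * (?e - 2 * d - s)) * P =
            real (m + 2) * - ((?e - d - s) * P - (c - d) * X)" for P X
          by (simp add: algebra_simps)
        then show ?thesis by (simp only:)
      qed
      also have "fact (m + 2) = real (m + 2) * fact (m + 1)" by (simp add: algebra_simps)
      also have "real (m + 2) * - ((?e - d - s) * (?B - s) ^ m - (c - d) * (c + real m * d) ^ m) /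
          (real (m + 2) * fact (m + 1)) = - ?f 1 s"
        by (simp add: PS_goncarov_def Let_def diff_divide_distrib del: of_nat_add of_nat_Suc fact_Suc)
      finally show ?thesis using 1 by simp
    next
      case 2
      then have "?f i = (\<lambda>s. (?e - d - s) - (c - d))" by (auto simp: PS_goncarov_def Let_def)
      moreover have "(\<dots> has_real_derivative - 1) (at s)"
        by (rule derivative_eq_intros refl)+ simp
      ultimately show ?thesis using 2 by (simp add: PS_goncarov_def)
    next
      case (3 k)
      have "?f 1 = (\<lambda>s. ((?e - d - s) * (?B - s) ^ Suc k - (c - d) * (c + real m * d) ^ m - 0 * (a - s))
          / fact (m + 1))"
        by (simp add: PS_goncarov_def Let_def fun_eq_iff 3)
      then have "(?f 1 has_real_derivative
          (0 - ((?B - s) + real (Suc k) * (?e - d - s)) * (?B - s) ^ k) / fact (m + 1)) (at s)"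
        by (simp only: has_real_derivative_goncarov_step)
      also have "(?B - s) + real (Suc k) * (?e - d - s) = real (m + 1) * (?e - s)"
        by (simp add: algebra_simps 3)
      also have "fact (m + 1) = real (m + 1) * fact m" by simp
      also have "(0 - real (m + 1) * (?e - s) * (?B - s) ^ k) / (real (m + 1) * fact m) = - ?f 2 s"
        by (simp add: PS_goncarov_def Let_def 3 del: of_nat_Suc fact_Suc)
      finally show ?thesis using 3 by (simp add: numeral_2_eq_2)
    next
      case 4
      then have "?f i = (\<lambda>s. ?e + real (i - 2) * d - s)" by (auto simp: PS_goncarov_def Let_def)
      moreover have "(\<dots> has_real_derivative - 1) (at s)"
        by (rule derivative_eq_intros refl)+ simp
      ultimately show ?thesis using 4 by (simp add: PS_goncarov_def)
    next
      case (5 j k)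
      have "?f i = (\<lambda>s. ((?e + real j * d - s) * (?B - s) ^ Suc k - 0 - 0 * (a - s)) / fact (k + 2))"
        by (simp add: PS_goncarov_def Let_def fun_eq_iff 5)
      then have "(?f i has_real_derivative
          (0 - ((?B - s) + real (Suc k) * (?e + real j * d - s)) * (?B - s) ^ k) / fact (k + 2)) (at s)"
        by (simp only: has_real_derivative_goncarov_step)
      also have "(?B - s) + real (Suc k) * (?e + real j * d - s) = real (k + 2) * (?e + real (Suc j) * d - s)"
        by (simp add: algebra_simps 5)
      also have "fact (k + 2) = real (k + 2) * fact (k + 1)" by (simp add: algebra_simps)
      also have "(0 - real (k + 2) * (?e + real (Suc j) * d - s) * (?B - s) ^ k) / (real (k + 2) * fact (k + 1)) =
          - ?f (Suc i) s"
        by (simp add: PS_goncarov_def Let_def 5 del: of_nat_add of_nat_Suc fact_Suc)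
      finally show ?thesis .
    qed
  qed
qed

text \<open>Partial sums of a list stay constant past its end while the closed form keeps growing,
  so agreement is only asked below \<open>n\<close>; \<open>0 < n\<close> puts index 0 in that
  range.\<close>

lemma goncarov_cong:
  assumes "goncarov n A f" and "\<And>i. i < n \<Longrightarrow> A' i = A i" and "0 < n"
  shows "goncarov n A' f"
  using assms by (simp add: goncarov_def)

theorem proposition5p5:
  fixes n :: nat and a b c d :: int
  assumes "n \<ge> 2" and "a > 0" and "b > 0" and "c > 0" and "d > 0"
  shows "normalized_volume (PS (n + 2)) ([a, b, c] @ replicate (n - 2) d) =
    of_int ((a + b + c - 2 * d) * (a + b + c + (int n - 2) * d) ^ (n - 1)
      - (b + c - 2 * d) * (b + c + (int n - 2) * d) ^ (n - 1)
      - int n * a * (c - d) * (c + (int n - 2) * d) ^ (n - 2))"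
proof -
  let ?as = "[a, b, c] @ replicate (n - 2) d"
  obtain m where n: "n = m + 2" using \<open>n \<ge> 2\<close> by (metis add.commute le_Suc_ex)
  then have m: "int n - 2 = int m" by simp
  let ?A = "\<lambda>i. real_of_int (sum_list (take (Suc i) ?as))"
  have A: "?A i = (if i = 0 then a else if i = 1 then a + b else a + b + c + real (i - 2) * d)"
    if "i < n" for i
    using that by (auto simp: n take_Cons' sum_list_replicate min_def)
  have "goncarov (m + 2) (\<lambda>i. if i = 0 then real_of_int a else if i = 1 then real_of_int a + of_int b
      else of_int a + of_int b + of_int c + real (i - 2) * of_int d) (PS_goncarov a b c d m)"
    using assms by (intro goncarov_PS_goncarov) auto
  then have "goncarov n ?A (PS_goncarov a b c d m)"
    unfolding n[symmetric] by (rule goncarov_cong) (use A n in auto)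
  then have "normalized_volume (PS (n + 2)) ?as = fact n * PS_goncarov a b c d m 0 0"
    using assms by (intro normalized_volume_PS) auto
  \<comment> \<open>The factor \<open>fact n\<close> cancels the denominator
    \<open>fact (m + 2)\<close> of the function for \<open>i = 0\<close>, evaluated at
    \<open>s = 0\<close>.\<close>
  also have "\<dots> = of_int ((a + b + c - 2 * d) * (a + b + c + (int n - 2) * d) ^ (n - 1)
      - (b + c - 2 * d) * (b + c + (int n - 2) * d) ^ (n - 1)
      - int n * a * (c - d) * (c + (int n - 2) * d) ^ (n - 2))"
    unfolding m by (simp add: PS_goncarov_def Let_def n mult_ac del: fact_Suc of_nat_Suc)
  finally show ?thesis .
qed

end
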